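(* Let $(X,d)$ be a metric space, $Y$ a real Hausdorff topological vector space, $K\subset Y$ a proper convex cone, and $H\subset K\setminus(-K)$ a nonempty set such that $H+K$ is convex. Let $\mathcal{A}\subseteq X\times 2^Y$ be nonempty with $A\ne\emptyset$ for every $(x,A)\in\mathcal{A}$. Assume that for every $\preceq_H$-decreasing sequence $((x_n,A_n))_{n\ge1}\subset\mathcal{A}$ with $(x_n)$ Cauchy there exists $(x,A)\in\mathcal{A}$ with $(x,A)\preceq_H(x_n,A_n)$ for all $n\ge1$. Let $(x_0,A_0)\in\mathcal{A}$ and $\varepsilon>0$ be such that $A_0\not\subset A+\varepsilon H+K$ for every $A$ with $(x,A)\in\mathcal{A}$ for some $x\in X$. Then there exists $(\overline{x},\overline{A})\in\mathcal{A}$ such that $(\overline{x},\overline{A})\preceq_H(x_0,A_0)$ and, for every $(x',A')\in\mathcal{A}$, $(x',A')\preceq_H(\overline{x},\overline{A})$ implies $x'=\overline{x}$; moreover, $d(\overline{x},x_0)<\varepsilon$.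
   Context: A proper convex cone $K$ satisfies $0\in K$, $K+K\subset K$, $tK\subset K$ for $t\ge0$, and $\{0\}\ne K\ne Y$. Sums of sets are Minkowski sums with $\emptyset+A=\emptyset$. The preorder $\preceq_H$ on $X\times2^Y$: $(x_1,A_1)\preceq_H(x_2,A_2)\iff A_2\subset A_1+d(x_1,x_2)H+K$. A sequence $(w_n)_{n\ge1}$ is $\preceq_H$-decreasing if $w_{n+1}\preceq_H w_n$ for all $n\ge1$. *)

theory Defs
  imports "HOL-Analysis.Analysis" "HOL-Library.Set_Algebras"
begin

text \<open>
  The Hausdorff property is kept separate, as the library class \<^class>\<open>t2_space\<close>.
\<close>

class real_tvs = topological_ab_group_add + real_vector +
  assumes tendsto_scaleR_Pair:
    "LIM p (nhds c \<times>\<^sub>F nhds x). fst p *\<^sub>R snd p :> nhds (c *\<^sub>R x)"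

instance real_normed_vector \<subseteq> real_tvs
proof
  fix c :: real and x :: 'a
  show "LIM p (nhds c \<times>\<^sub>F nhds x). fst p *\<^sub>R snd p :> nhds (c *\<^sub>R x)"
    by (intro tendsto_scaleR filterlim_fst filterlim_snd)
qed

text \<open>
  On sets, \<open>+\<close> is the Minkowski sum of \<^theory>\<open>HOL-Library.Set_Algebras\<close>, so that
  \<open>{} + A = {}\<close>. The multiple \<open>c H\<close> is the image of \<open>H\<close> under \<open>(*\<^sub>R) c\<close>; in particular
  \<open>0 H = {0}\<close> for nonempty \<open>H\<close>. The reflected cone is \<open>uminus ` K\<close>, because \<open>- K\<close> would
  denote the complement of \<open>K\<close>.
\<close>

definition proper_convex_cone :: "'y::real_vector set \<Rightarrow> bool" where
  "proper_convex_cone K \<longleftrightarrow>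
     0 \<in> K \<and> K + K \<subseteq> K \<and> (\<forall>t\<ge>0. (*\<^sub>R) t ` K \<subseteq> K) \<and> K \<noteq> {0} \<and> K \<noteq> UNIV"

definition preceq ::
  "'y::real_vector set \<Rightarrow> 'y set \<Rightarrow> 'x::metric_space \<times> 'y set \<Rightarrow> 'x \<times> 'y set \<Rightarrow> bool" where
  "preceq K H w\<^sub>1 w\<^sub>2 \<longleftrightarrow>
     snd w\<^sub>2 \<subseteq> snd w\<^sub>1 + (*\<^sub>R) (dist (fst w\<^sub>1) (fst w\<^sub>2)) ` H + K"

text \<open>Sequences are indexed from 0.\<close>

definition preceq_decreasing ::
  "'y::real_vector set \<Rightarrow> 'y set \<Rightarrow> (nat \<Rightarrow> 'x::metric_space \<times> 'y set) \<Rightarrow> bool" where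
  "preceq_decreasing K H w \<longleftrightarrow> (\<forall>n. preceq K H (w (Suc n)) (w n))"

end

theory Submission
  imports Defs
begin

text \<open>
  By convexity of \<open>H + K\<close>, the increments \<open>dist x y\<close> along a decreasing chain starting at
  \<open>(x\<^sub>0, A\<^sub>0)\<close> add up: \<open>A\<^sub>0 \<subseteq> A + t H + K\<close> with \<open>t\<close> the length of the chain. The hypothesis on \<open>\<epsilon>\<close>
  then forces \<open>t < \<epsilon>\<close>, so every such chain is Cauchy and has a lower bound. Choosing each step at
  least half as long as the longest possible one makes the lower bound minimal.
\<close>

text \<open>A bounded series of nonnegative terms converges, and distances between terms of
  \<open>x\<close> are dominated by differences of its partial sums.\<close>

lemma Cauchy_if_bounded_length:
  fixes x :: "nat \<Rightarrow> 'x::metric_space"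
  assumes "\<And>n. (\<Sum>i<n. dist (x (Suc i)) (x i)) \<le> B"
  shows "Cauchy x" and "(\<lambda>n. dist (x (Suc n)) (x n)) \<longlonglongrightarrow> 0"
proof -
  let ?S = "\<lambda>n. \<Sum>i<n. dist (x (Suc i)) (x i)"
  have sums: "summable (\<lambda>n. dist (x (Suc n)) (x n))"
    by (rule summableI_nonneg_bounded[OF _ assms]) simp
  then show "(\<lambda>n. dist (x (Suc n)) (x n)) \<longlonglongrightarrow> 0"
    by (rule summable_LIMSEQ_zero)
  have le: "dist (x m) (x n) \<le> ?S n - ?S m" if "m \<le> n" for m n
    using that
  proof (induction n rule: dec_induct)
    case (step n)
    have "dist (x m) (x (Suc n)) \<le> dist (x m) (x n) + dist (x (Suc n)) (x n)"
      by (metis dist_commute dist_triangle)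
    with step.IH show ?case by simp
  qed simp
  have "Cauchy ?S"
    using sums by (simp add: summable_iff_convergent convergent_Cauchy)
  then show "Cauchy x"
    unfolding Cauchy_altdef
    by (smt (verit, best) le dist_real_def less_imp_le)
qed

text \<open>An abstract form in which \<open>Q t w\<close> certifies that \<open>w\<close> can be
  reached from \<open>w0\<close> with total length \<open>t\<close>; \<open>step\<close> adds
  lengths and \<open>bound\<close> caps them. Any \<open>v\<close> below the lower bound
  \<open>z\<close> of a greedy chain lies below all its terms, so its distance to each term is at
  most twice the next increment. These increments tend to 0, which leaves only one possible value
  for \<open>p v\<close>.\<close>

lemma exists_minimal_element:
  fixes P :: "'a \<Rightarrow> 'a \<Rightarrow> bool" and p :: "'a \<Rightarrow> 'x::metric_space"
    and Q :: "real \<Rightarrow> 'a \<Rightarrow> bool"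
  assumes refl: "\<And>w. P w w"
    and trans: "\<And>u v w. P u v \<Longrightarrow> P v w \<Longrightarrow> P u w"
    and w0: "w0 \<in> A" "Q 0 w0"
    and step: "\<And>t v w. Q t w \<Longrightarrow> 0 \<le> t \<Longrightarrow> P v w \<Longrightarrow> Q (t + dist (p v) (p w)) v"
    and bound: "\<And>t w. w \<in> A \<Longrightarrow> Q t w \<Longrightarrow> t < \<epsilon>"
    and lower: "\<And>w. range w \<subseteq> A \<Longrightarrow> (\<And>n. P (w (Suc n)) (w n)) \<Longrightarrow> Cauchy (\<lambda>n. p (w n))
        \<Longrightarrow> \<exists>z\<in>A. \<forall>n. P z (w n)"
  shows "\<exists>z\<in>A. P z w0 \<and> (\<forall>v\<in>A. P v z \<longrightarrow> p v = p z)"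
proof -
  have far: "\<exists>u\<in>A. P u w \<and> (\<forall>v\<in>A. P v w \<longrightarrow> dist (p v) (p w) \<le> 2 * dist (p u) (p w))"
    if "w \<in> A" "Q t w" "0 \<le> t" for t w
  proof -
    let ?D = "{dist (p v) (p w) | v. v \<in> A \<and> P v w}"
    \<comment> \<open>Moving from \<open>w\<close> to \<open>v\<close> raises the certified length
      from \<open>t\<close> to \<open>t\<close> plus the distance, which must stay below
      \<epsilon>.\<close>
    have bdd: "bdd_above ?D"
    proof (rule bdd_aboveI[of _ \<epsilon>])
      fix d assume "d \<in> ?D"
      then obtain v where v: "v \<in> A" "P v w" "d = dist (p v) (p w)" by blast
      show "d \<le> \<epsilon>"
        using bound[OF v(1) step[OF that(2,3) v(2)]] v(3) that(3) by linarith
    qed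
    have upper: "dist (p v) (p w) \<le> Sup ?D" if "v \<in> A" "P v w" for v
      using that by (intro cSup_upper bdd) blast
    show ?thesis
    \<comment> \<open>Half of the supremum lies strictly below it only when it is positive;
      otherwise \<open>w\<close> itself serves as \<open>u\<close>.\<close>
    proof (cases "Sup ?D \<le> 0")
      case True
      then have "dist (p v) (p w) \<le> 2 * dist (p w) (p w)" if "v \<in> A" "P v w" for v
        using order_trans[OF upper[OF that] True] by simp
      then show ?thesis using refl that(1) by blast
    next
      case False
      moreover have "?D \<noteq> {}" using refl that(1) by blast
      ultimately obtain u where "u \<in> A" "P u w" "Sup ?D / 2 < dist (p u) (p w)"
        using less_cSup_iff[OF _ bdd, of "Sup ?D / 2"] by auto
      moreover from this have "dist (p v) (p w) \<le> 2 * dist (p u) (p w)"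
        if "v \<in> A" "P v w" for v
        using upper[OF that] by simp
      ultimately show ?thesis by blast
    qed
  qed
  \<comment> \<open>The clause for \<open>n = 0\<close> pins the start of the chain. The length
    stays existential here, as \<open>far\<close> needs only some certificate; the actual sum is
    recovered by induction afterwards.\<close>
  have "\<exists>f. \<forall>n. (f n \<in> A \<and> (\<exists>t\<ge>0. Q t (f n)) \<and> (n = 0 \<longrightarrow> f n = w0)) \<and>
      (P (f (Suc n)) (f n) \<and>
       (\<forall>v\<in>A. P v (f n) \<longrightarrow> dist (p v) (p (f n)) \<le> 2 * dist (p (f (Suc n))) (p (f n))))"
  proof (rule dependent_nat_choice)
    show "\<exists>w. w \<in> A \<and> (\<exists>t\<ge>0. Q t w) \<and> (0 = (0::nat) \<longrightarrow> w = w0)"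
      using w0 by auto
  next
    fix w and n :: nat
    assume "w \<in> A \<and> (\<exists>t\<ge>0. Q t w) \<and> (n = 0 \<longrightarrow> w = w0)"
    then obtain t where w: "w \<in> A" "Q t w" "0 \<le> t" by blast
    obtain u where u: "u \<in> A" "P u w"
      "\<forall>v\<in>A. P v w \<longrightarrow> dist (p v) (p w) \<le> 2 * dist (p u) (p w)"
      using far[OF w] by blast
    have "\<exists>t\<ge>0. Q t u"
      using step[OF w(2,3) u(2)] w(3) by (intro exI[of _ "t + dist (p u) (p w)"]) simp
    then show "\<exists>u. (u \<in> A \<and> (\<exists>t\<ge>0. Q t u) \<and> (Suc n = 0 \<longrightarrow> u = w0)) \<and>
        (P u w \<and> (\<forall>v\<in>A. P v w \<longrightarrow> dist (p v) (p w) \<le> 2 * dist (p u) (p w)))"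
      using u by blast
  qed
  then obtain f where f: "\<And>n. f n \<in> A" "f 0 = w0" "\<And>n. P (f (Suc n)) (f n)"
    and long: "\<And>n v. v \<in> A \<Longrightarrow> P v (f n) \<Longrightarrow>
      dist (p v) (p (f n)) \<le> 2 * dist (p (f (Suc n))) (p (f n))"
    by metis
  have "Q (\<Sum>i<n. dist (p (f (Suc i))) (p (f i))) (f n)" for n
  proof (induction n)
    case 0
    show ?case using w0 f(2) by simp
  next
    case (Suc n)
    have "0 \<le> (\<Sum>i<n. dist (p (f (Suc i))) (p (f i)))" by (simp add: sum_nonneg)
    from step[OF Suc this f(3)[of n]] show ?case by simp
  qed
  then have len: "(\<Sum>i<n. dist (p (f (Suc i))) (p (f i))) \<le> \<epsilon>" for n
    using bound f(1) less_imp_le by blast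
  obtain z where z: "z \<in> A" "\<And>n. P z (f n)"
    using lower[of f] Cauchy_if_bounded_length(1)[OF len] f by blast
  have lim: "(\<lambda>n. 2 * dist (p (f (Suc n))) (p (f n))) \<longlonglongrightarrow> 0"
    using tendsto_mult_right_zero[OF Cauchy_if_bounded_length(2)[OF len]] .
  \<comment> \<open>By reflexivity this also covers \<open>z\<close>, so uniqueness of limits
    identifies \<open>p v\<close> with \<open>p z\<close>.\<close>
  have conv: "(\<lambda>n. p (f n)) \<longlonglongrightarrow> p v" if "v \<in> A" "P v z" for v
  proof -
    have "\<forall>n. norm (dist (p (f n)) (p v)) \<le> 2 * dist (p (f (Suc n))) (p (f n))"
      using long[OF that(1) trans[OF that(2) z(2)]] by (simp add: dist_commute)
    then show ?thesis
      unfolding tendsto_dist_iff[of _ "p v"]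
      by (intro Lim_null_comparison[OF _ lim] always_eventually)
  qed
  have "p v = p z" if "v \<in> A" "P v z" for v
    using LIMSEQ_unique[OF conv[OF that] conv[OF z(1) refl]] .
  then show ?thesis using z f(2) by metis
qed

text \<open>Convexity of \<open>H + K\<close> with weights \<open>s / (s + t)\<close> and
  \<open>t / (s + t)\<close> merges the two elements of \<open>H\<close> into one, up to an error
  that \<open>K\<close> absorbs.\<close>

lemma scaled_plus_cone_add:
  fixes K H :: "'y::real_vector set"
  assumes K: "proper_convex_cone K" and "convex (H + K)" and "0 \<le> s" "0 \<le> t"
  shows "((*\<^sub>R) s ` H + K) + ((*\<^sub>R) t ` H + K) \<subseteq> (*\<^sub>R) (s + t) ` H + K"
proof
  fix y assume "y \<in> ((*\<^sub>R) s ` H + K) + ((*\<^sub>R) t ` H + K)"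
  then obtain h1 k1 h2 k2 where h: "h1 \<in> H" "h2 \<in> H" and k: "k1 \<in> K" "k2 \<in> K"
    and y: "y = (s *\<^sub>R h1 + k1) + (t *\<^sub>R h2 + k2)"
    by (auto elim!: set_plus_elim)
  have K0: "0 \<in> K" and Kadd: "\<And>a b. a \<in> K \<Longrightarrow> b \<in> K \<Longrightarrow> a + b \<in> K"
    and Kscale: "\<And>a c. a \<in> K \<Longrightarrow> 0 \<le> c \<Longrightarrow> c *\<^sub>R a \<in> K"
    using K unfolding proper_convex_cone_def by auto
  show "y \<in> (*\<^sub>R) (s + t) ` H + K"
  proof (cases "s + t = 0")
    \<comment> \<open>The weights make no sense here, but both multiples of \<open>H\<close> reduce
      to 0 and any element of \<open>H\<close> is a witness.\<close>
    case True
    then have "s = 0" "t = 0" using assms(3,4) by auto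
    then have "y = (s + t) *\<^sub>R h1 + (k1 + k2)" using y by simp
    then show ?thesis using h k Kadd by (auto intro!: set_plus_intro)
  next
    case False
    with assms(3,4) have pos: "s + t > 0" by simp
    have HK: "h1 \<in> H + K" "h2 \<in> H + K"
      using set_plus_intro[OF h(1) K0] set_plus_intro[OF h(2) K0] by auto
    have "(s / (s + t)) *\<^sub>R h1 + (t / (s + t)) *\<^sub>R h2 \<in> H + K"
      using pos assms(3,4)
      by (intro convexD[OF assms(2) HK]) (auto simp flip: add_divide_distrib)
    then obtain h k where hk: "h \<in> H" "k \<in> K"
      "(s / (s + t)) *\<^sub>R h1 + (t / (s + t)) *\<^sub>R h2 = h + k"
      by (auto elim: set_plus_elim)
    have "s *\<^sub>R h1 + t *\<^sub>R h2 = (s + t) *\<^sub>R ((s / (s + t)) *\<^sub>R h1 + (t / (s + t)) *\<^sub>R h2)"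
      using pos by (simp add: scaleR_right_distrib)
    also have "\<dots> = (s + t) *\<^sub>R h + (s + t) *\<^sub>R k"
      unfolding hk(3) by (rule scaleR_right_distrib)
    finally have "y = (s + t) *\<^sub>R h + ((s + t) *\<^sub>R k + (k1 + k2))"
      using y by (simp add: algebra_simps)
    moreover have "(s + t) *\<^sub>R k + (k1 + k2) \<in> K"
      using hk k pos Kadd Kscale by simp
    ultimately show ?thesis using hk(1) by (auto intro!: set_plus_intro)
  qed
qed

text \<open>The surplus \<open>(t - s) *\<^sub>R h\<close> lies in \<open>K\<close>.\<close>

lemma scaled_plus_cone_antimono:
  fixes K H :: "'y::real_vector set"
  assumes K: "proper_convex_cone K" and "H \<subseteq> K" and "s \<le> t"
  shows "(*\<^sub>R) t ` H + K \<subseteq> (*\<^sub>R) s ` H + K"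
proof
  fix y assume "y \<in> (*\<^sub>R) t ` H + K"
  then obtain h k where h: "h \<in> H" "k \<in> K" "y = t *\<^sub>R h + k"
    by (auto elim!: set_plus_elim)
  have "h \<in> K" and "0 \<le> t - s"
    using h(1) assms(2,3) by auto
  then have "(t - s) *\<^sub>R h \<in> K"
    using K unfolding proper_convex_cone_def by blast
  then have "(t - s) *\<^sub>R h + k \<in> K"
    using K set_plus_intro[OF _ h(2)] unfolding proper_convex_cone_def by blast
  moreover have "y = s *\<^sub>R h + ((t - s) *\<^sub>R h + k)"
    using h(3) by (simp add: algebra_simps)
  ultimately show "y \<in> (*\<^sub>R) s ` H + K"
    using h(1) by (auto intro!: set_plus_intro)
qed

text \<open>Chaining two inclusions adds their lengths. This yields both the transitivity of
  \<open>preceq\<close> and the growth of the certified length along a chain.\<close>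

lemma scaled_plus_cone_compose:
  fixes K H :: "'y::real_vector set"
  assumes K: "proper_convex_cone K" and conv: "convex (H + K)" and "0 \<le> s" "0 \<le> t"
    and sub: "C \<subseteq> B + (*\<^sub>R) s ` H + K" "B \<subseteq> A + (*\<^sub>R) t ` H + K"
  shows "C \<subseteq> A + (*\<^sub>R) (s + t) ` H + K"
proof -
  have "C \<subseteq> (A + (*\<^sub>R) t ` H + K) + ((*\<^sub>R) s ` H + K)"
    using sub set_plus_mono2[OF sub(2) subset_refl] by (auto simp: add.assoc)
  also have "\<dots> = A + (((*\<^sub>R) t ` H + K) + ((*\<^sub>R) s ` H + K))"
    by (simp only: add.assoc)
  also have "\<dots> \<subseteq> A + ((*\<^sub>R) (t + s) ` H + K)"
    by (intro set_plus_mono2 subset_refl scaled_plus_cone_add assms)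
  finally show ?thesis by (simp add: add.assoc add.commute[of s t])
qed

text \<open>For nonempty \<open>H\<close> the multiple by 0 is the singleton of 0, whereas for empty
  \<open>H\<close> the sum would be empty. This gives reflexivity and the certificate of length
  0.\<close>

lemma subset_plus_zero_scaled_plus_cone:
  fixes K H :: "'y::real_vector set"
  assumes "0 \<in> K" "H \<noteq> {}"
  shows "A \<subseteq> A + (*\<^sub>R) 0 ` H + K"
proof -
  have "(*\<^sub>R) 0 ` H = 0" using assms(2) by (auto simp: set_zero)
  then show ?thesis using assms(1) set_zero_plus2[of K A] by (simp add: add.commute)
qed

theorem theorem5p9:
  fixes K H :: "'y::{real_tvs, t2_space} set"
    and \<A> :: "('x::metric_space \<times> 'y set) set"
    and x\<^sub>0 :: 'x and A\<^sub>0 :: "'y set" and \<epsilon> :: real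
  assumes K: "proper_convex_cone K"
    and H: "H \<noteq> {}" "H \<subseteq> K - uminus ` K" "convex (H + K)"
    and \<A>_nonempty: "\<A> \<noteq> {}"
    and values_nonempty: "\<And>x A. (x, A) \<in> \<A> \<Longrightarrow> A \<noteq> {}"
    and lower_bound: "\<And>w. \<lbrakk>range w \<subseteq> \<A>; preceq_decreasing K H w; Cauchy (\<lambda>n. fst (w n))\<rbrakk>
           \<Longrightarrow> \<exists>(x, A) \<in> \<A>. \<forall>n. preceq K H (x, A) (w n)"
    and start: "(x\<^sub>0, A\<^sub>0) \<in> \<A>"
    and \<epsilon>: "\<epsilon> > 0" "\<And>x A. (x, A) \<in> \<A> \<Longrightarrow> \<not> A\<^sub>0 \<subseteq> A + (*\<^sub>R) \<epsilon> ` H + K"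
  shows "\<exists>(xbar, Abar) \<in> \<A>.
           preceq K H (xbar, Abar) (x\<^sub>0, A\<^sub>0) \<and>
           (\<forall>(x', A') \<in> \<A>. preceq K H (x', A') (xbar, Abar) \<longrightarrow> x' = xbar) \<and>
           dist xbar x\<^sub>0 < \<epsilon>"
proof -
  let ?Q = "\<lambda>t w. A\<^sub>0 \<subseteq> snd w + (*\<^sub>R) t ` H + K"
  have K0: "0 \<in> K" using K unfolding proper_convex_cone_def by blast
  have HK: "H \<subseteq> K" using H(2) by blast
  note antimono = set_plus_mono2[OF subset_refl scaled_plus_cone_antimono[OF K HK]]
  have step: "?Q (t + dist (fst v) (fst w)) v" if "?Q t w" "0 \<le> t" "preceq K H v w" for t v w
    using scaled_plus_cone_compose[OF K H(3) that(2) zero_le_dist that(1) that(3)[unfolded preceq_def]] .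
  have zero: "?Q 0 (x\<^sub>0, A\<^sub>0)"
    using subset_plus_zero_scaled_plus_cone[OF K0 H(1)] by simp
  \<comment> \<open>A length of at least \<epsilon> could be shrunk to \<epsilon> by
    antimonotonicity, giving exactly the inclusion excluded for \<epsilon>.\<close>
  have bound: "t < \<epsilon>" if "w \<in> \<A>" "?Q t w" for t w
  proof (rule ccontr)
    assume "\<not> t < \<epsilon>"
    then have "A\<^sub>0 \<subseteq> snd w + (*\<^sub>R) \<epsilon> ` H + K"
      using that(2) antimono[of \<epsilon> t "snd w"] by (auto simp: add.assoc)
    then show False using \<epsilon>(2)[of "fst w" "snd w"] that(1) by simp
  qed
  have "\<exists>z\<in>\<A>. preceq K H z (x\<^sub>0, A\<^sub>0) \<and> (\<forall>v\<in>\<A>. preceq K H v z \<longrightarrow> fst v = fst z)"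
  proof (rule exists_minimal_element[where Q = ?Q, OF _ _ start zero step bound])
    show "preceq K H w w" for w :: "'x \<times> 'y set"
      using subset_plus_zero_scaled_plus_cone[OF K0 H(1)] by (simp add: preceq_def)
    show "preceq K H u w" if "preceq K H u v" "preceq K H v w" for u v w :: "'x \<times> 'y set"
    proof -
      have "snd w \<subseteq> snd u + (*\<^sub>R) (dist (fst v) (fst w) + dist (fst u) (fst v)) ` H + K"
        using that unfolding preceq_def
        by (intro scaled_plus_cone_compose[OF K H(3)]) auto
      \<comment> \<open>The composed length may exceed the direct distance; antimonotonicity permits
        replacing it by the smaller one.\<close>
      moreover have "dist (fst u) (fst w) \<le> dist (fst v) (fst w) + dist (fst u) (fst v)"
        by (metis add.commute dist_triangle)
      ultimately show ?thesis
        using antimono unfolding preceq_def add.assoc by blast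
    qed
    show "\<exists>z\<in>\<A>. \<forall>n. preceq K H z (w n)"
      if "range w \<subseteq> \<A>" "\<And>n. preceq K H (w (Suc n)) (w n)" "Cauchy (\<lambda>n. fst (w n))" for w
      using lower_bound[of w] that unfolding preceq_decreasing_def by blast
  qed
  then obtain z where z: "z \<in> \<A>" "preceq K H z (x\<^sub>0, A\<^sub>0)"
    "\<forall>v\<in>\<A>. preceq K H v z \<longrightarrow> fst v = fst z" by blast
  \<comment> \<open>The pair \<open>z\<close> lies directly below the start, so this single step is
    a chain of length \<open>dist (fst z) x\<^sub>0\<close>, to which \<open>bound\<close>
    applies.\<close>
  have "dist (fst z) x\<^sub>0 < \<epsilon>"
    using bound[OF z(1) step[OF zero order_refl z(2)]] by simp
  with z show ?thesis by (intro bexI[of _ z]) auto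
qed

end
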